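(* For a fixed integer $r\geq1$, the set $\{\varepsilon(r,s,p) : s\ge r \text{ an integer},\ p \text{ a prime}\}$ has at most $2^{r-1}$ elements.
   Context: For a positive integer $n$, let $J_n$ denote the $n\times n$ matrix with $1$s in positions $(i,i)$ for $1\le i\le n$ and $(i,i+1)$ for $1\le i<n$, and $0$s elsewhere. For $1\le r\le s$ and a field $F$ of prime characteristic $p$, the Jordan canonical form of $J_r\otimes J_s$ over $F$ is $J_{\lambda_1}\oplus\cdots\oplus J_{\lambda_r}$ with $\lambda_1\ge\cdots\ge\lambda_r>0$; write $\lambda(r,s,p)=(\lambda_1,\dots,\lambda_r)$ (depending only on $r,s,p$). The deviation vector is $\varepsilon(r,s,p)=(\lambda_1-s,\dots,\lambda_r-s)$. *)

theory Defs
  imports "HOL-Number_Theory.Number_Theory"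
begin

text \<open>Matrices are represented as functions nat => nat => int (0-indexed), with the
  dimension tracked separately; arithmetic over the prime field F_p is arithmetic
  of integers modulo p.\<close>

definition Jmat :: "nat \<Rightarrow> nat \<Rightarrow> nat \<Rightarrow> int" where
  "Jmat n i j = (if i < n \<and> j < n \<and> (j = i \<or> j = Suc i) then 1 else 0)"

definition kron :: "nat \<Rightarrow> nat \<Rightarrow> (nat \<Rightarrow> nat \<Rightarrow> int) \<Rightarrow> (nat \<Rightarrow> nat \<Rightarrow> int) \<Rightarrow> nat \<Rightarrow> nat \<Rightarrow> int" where
  "kron r s A B i j = (if i < r * s \<and> j < r * s
      then A (i div s) (j div s) * B (i mod s) (j mod s) else 0)"

fun jordan_sum :: "nat list \<Rightarrow> nat \<Rightarrow> nat \<Rightarrow> int" where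
  "jordan_sum [] i j = 0"
| "jordan_sum (n # ns) i j =
     (if i < n \<and> j < n then Jmat n i j
      else if n \<le> i \<and> n \<le> j then jordan_sum ns (i - n) (j - n) else 0)"

definition matmul :: "nat \<Rightarrow> (nat \<Rightarrow> nat \<Rightarrow> int) \<Rightarrow> (nat \<Rightarrow> nat \<Rightarrow> int) \<Rightarrow> nat \<Rightarrow> nat \<Rightarrow> int" where
  "matmul n A B i j = (\<Sum>k<n. A i k * B k j)"

definition similar_mod :: "nat \<Rightarrow> nat \<Rightarrow> (nat \<Rightarrow> nat \<Rightarrow> int) \<Rightarrow> (nat \<Rightarrow> nat \<Rightarrow> int) \<Rightarrow> bool" where
  "similar_mod p n A B = (\<exists>P Q.
      (\<forall>i<n. \<forall>j<n. [matmul n P Q i j = (if i = j then 1 else 0)] (mod int p)) \<and>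
      (\<forall>i<n. \<forall>j<n. [matmul n P A i j = matmul n B P i j] (mod int p)))"

definition jlambda :: "nat \<Rightarrow> nat \<Rightarrow> nat \<Rightarrow> nat list" where
  "jlambda r s p = (THE lam. sorted_wrt (\<ge>) lam \<and> (\<forall>x\<in>set lam. 0 < x) \<and>
      sum_list lam = r * s \<and> similar_mod p (r * s) (kron r s (Jmat r) (Jmat s)) (jordan_sum lam))"

definition deviation :: "nat \<Rightarrow> nat \<Rightarrow> nat \<Rightarrow> int list" where
  "deviation r s p = map (\<lambda>l. int l - int s) (jlambda r s p)"

end

theory Submission
  imports Defs "HOL-Computational_Algebra.Polynomial"
begin

text \<open>
  Row vectors of length \<open>r s\<close> modulo \<open>p\<close> form \<open>A = F[x,y]/(x\<^sup>r, y\<^sup>s)\<close>, on which \<open>J\<^sub>r \<otimes> J\<^sub>s\<close> is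
  multiplication by \<open>(1 + x)(1 + y) = 1 + z\<close>, where \<open>z = x + y'\<close> and \<open>y' = y (1 + x)\<close>. In the variables
  \<open>x, y'\<close> the \<open>F[z]\<close>-module \<open>A\<close> is graded, with one generator in each degree \<open>a < r\<close>. Let \<open>m a\<close> be the
  least \<open>m\<close> such that \<open>z\<close> to the power \<open>s + m - 1 - a\<close> kills some form of degree \<open>a\<close> that is nonzero
  modulo \<open>z\<close>. Multiplication by \<open>x\<close> gives \<open>m (a + 1) \<le> m a + 1\<close>, and minimality makes \<open>m\<close> injective with
  values in \<open>{1..r}\<close>. Hence the Jordan blocks have sizes \<open>s + m a - 1 - a\<close>, already in decreasing order,
  and the deviation vector is \<open>(m a - 1 - a)\<close>. A permutation in which every ascent is by exactly one
  is determined by its set of descents, a subset of a set with \<open>r - 1\<close> elements.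
\<close>

subsection \<open>Permutations whose ascents are by one\<close>

text \<open>The values of \<open>m\<close> start at 1. Such an \<open>m\<close> splits into runs of consecutive integers, and the runs
  descend, so \<open>m\<close> is determined by the positions of its descents.\<close>

definition slow_perm :: "nat \<Rightarrow> (nat \<Rightarrow> nat) \<Rightarrow> bool" where
  "slow_perm r m \<longleftrightarrow> inj_on m {..<r} \<and> m ` {..<r} \<subseteq> {1..r} \<and>
     (\<forall>a. Suc a < r \<longrightarrow> m (Suc a) \<le> Suc (m a))"

lemma slow_perm_image:
  assumes "slow_perm r m"
  shows "m ` {..<r} = {1..r}"
  using assms unfolding slow_perm_def
  by (intro card_subset_eq) (auto simp: card_image)

text \<open>Later values climb by at most one at a time, so to rise above \<open>m c\<close> again
  they would have to take the value \<open>m c\<close>, which injectivity forbids.\<close>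

lemma slow_perm_less_after_descent:
  assumes m: "slow_perm r m" and c: "Suc c < r" "m (Suc c) \<noteq> Suc (m c)"
  shows "c < b \<Longrightarrow> b < r \<Longrightarrow> m b < m c"
proof (induction b)
  case (Suc b)
  have ne: "m (Suc b) \<noteq> m c"
    using m Suc.prems inj_onD[of m "{..<r}" "Suc b" c] unfolding slow_perm_def by auto
  have le: "m (Suc b) \<le> Suc (m b)"
    using m Suc.prems unfolding slow_perm_def by auto
  show ?case
  proof (cases "b = c")
    case True
    with c(2) le ne show ?thesis by auto
  next
    case False
    with Suc have "m b < m c" by auto
    with le ne show ?thesis by auto
  qed
qed simp

text \<open>Going down from \<open>c\<close>: if \<open>m\<close> ascends at \<open>a\<close>, then
  \<open>m a\<close> is only one below \<open>m (Suc a)\<close> and still differs from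
  \<open>m b\<close>; otherwise \<open>a\<close> is itself a descent and the previous lemma
  applies.\<close>

lemma slow_perm_less_across_descent:
  assumes m: "slow_perm r m" and c: "Suc c < r" "m (Suc c) \<noteq> Suc (m c)"
    and ac: "a \<le> c" and b: "c < b" "b < r"
  shows "m b < m a"
  using ac
proof (induction a rule: inc_induct)
  case base
  show ?case using slow_perm_less_after_descent[OF m c b] .
next
  case (step a)
  have ne: "m b \<noteq> m a"
    using m step.hyps b inj_onD[of m "{..<r}" b a] unfolding slow_perm_def by auto
  show ?case
  proof (cases "m (Suc a) = Suc (m a)")
    case True
    with step.IH ne show ?thesis by auto
  next
    case False
    then show ?thesis
      using slow_perm_less_after_descent[OF m, of a b] step.hyps b by auto
  qed
qed

lemma slow_perm_less_iff:
  assumes m: "slow_perm r m" and ab: "a < b" "b < r"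
  shows "m a < m b \<longleftrightarrow> (\<forall>c\<in>{a..<b}. m (Suc c) = Suc (m c))"
proof
  assume "m a < m b"
  then show "\<forall>c\<in>{a..<b}. m (Suc c) = Suc (m c)"
    using slow_perm_less_across_descent[OF m, of _ a b] ab
    by (metis atLeastLessThan_iff less_asym less_trans_Suc order_le_less_trans Suc_leI)
next
  assume *: "\<forall>c\<in>{a..<b}. m (Suc c) = Suc (m c)"
  have "m a \<le> m i \<and> (a < i \<longrightarrow> m a < m i)" if "a \<le> i" "i \<le> b" for i
    using that
  proof (induction i rule: dec_induct)
    case (step i)
    then show ?case using * by auto
  qed simp
  with ab show "m a < m b" by simp
qed

text \<open>The values fill \<open>{1..r}\<close>, so each one is fixed by its rank; thus the
  relative order of the values determines \<open>m\<close>.\<close>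

lemma slow_perm_eq_card:
  assumes m: "slow_perm r m" and a: "a < r"
  shows "m a = Suc (card {b. b < r \<and> m b < m a})"
proof -
  have im: "m ` {..<r} = {1..r}" by (rule slow_perm_image[OF m])
  have "m ` {b. b < r \<and> m b < m a} = {1..<m a}"
  proof -
    have "m a \<le> r" using im a by auto
    have "x \<in> m ` {b. b < r \<and> m b < m a}" if "x \<in> {1..<m a}" for x
    proof -
      have "x \<in> m ` {..<r}" unfolding im using that \<open>m a \<le> r\<close> by auto
      with that show ?thesis by auto
    qed
    moreover have "1 \<le> m b" if "b < r" for b using im that by auto
    ultimately show ?thesis by auto
  qed
  moreover have "inj_on m {b. b < r \<and> m b < m a}"
    using m unfolding slow_perm_def by (auto intro: inj_on_subset)
  ultimately have "card {b. b < r \<and> m b < m a} = card {1..<m a}"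
    using card_image by metis
  moreover have "1 \<le> m a" using im a by auto
  ultimately show ?thesis by simp
qed

lemma slow_perm_unique:
  assumes m: "slow_perm r m" and m': "slow_perm r m'"
    and desc: "\<And>c. Suc c < r \<Longrightarrow> m (Suc c) = Suc (m c) \<longleftrightarrow> m' (Suc c) = Suc (m' c)"
    and a: "a < r"
  shows "m a = m' a"
proof -
  have lt: "m b < m c \<longleftrightarrow> m' b < m' c" if "b < c" "c < r" for b c
    using slow_perm_less_iff[OF m that] slow_perm_less_iff[OF m' that] desc that by auto
  have ne: "m b \<noteq> m c" "m' b \<noteq> m' c" if "b < r" "c < r" "b \<noteq> c" for b c
    using m m' that unfolding slow_perm_def by (auto dest: inj_onD)
  have "m b < m a \<longleftrightarrow> m' b < m' a" if "b < r" for b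
    using lt[of a b] lt[of b a] ne[of a b] that a
    by (metis linorder_neqE_nat less_irrefl less_asym)
  then have "{b. b < r \<and> m b < m a} = {b. b < r \<and> m' b < m' a}" by auto
  then show ?thesis using slow_perm_eq_card[OF m a] slow_perm_eq_card[OF m' a] by simp
qed

lemma card_slow_perm_deviations:
  fixes r :: nat
  defines "D \<equiv> {map (\<lambda>a. int (m a) - 1 - int a) [0..<r] | m. slow_perm r m}"
  shows "finite D \<and> card D \<le> 2 ^ (r - 1)"
proof -
  \<comment> \<open>The term \<open>- int a\<close> cancels an ascent by one, so adjacent entries of
    \<open>d\<close> agree exactly where \<open>m\<close> ascends.\<close>
  define desc :: "int list \<Rightarrow> nat set" where "desc d = {a. Suc a < r \<and> d ! Suc a \<noteq> d ! a}" for d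
  have "inj_on desc D"
  proof (rule inj_onI)
    fix d d' assume "d \<in> D" "d' \<in> D" and eq: "desc d = desc d'"
    then obtain m m' where m: "slow_perm r m" "slow_perm r m'"
      and d: "d = map (\<lambda>a. int (m a) - 1 - int a) [0..<r]"
      and d': "d' = map (\<lambda>a. int (m' a) - 1 - int a) [0..<r]"
      unfolding D_def by blast
    have "desc d = {a. Suc a < r \<and> m (Suc a) \<noteq> Suc (m a)}"
      "desc d' = {a. Suc a < r \<and> m' (Suc a) \<noteq> Suc (m' a)}"
      unfolding desc_def d d' by auto
    with eq have "m (Suc c) = Suc (m c) \<longleftrightarrow> m' (Suc c) = Suc (m' c)" if "Suc c < r" for c
      using that by blast
    then have "m a = m' a" if "a < r" for a using slow_perm_unique[OF m] that by blast
    then show "d = d'" unfolding d d' by simp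
  qed
  moreover have "desc ` D \<subseteq> Pow {..<r - 1}" unfolding desc_def by auto
  ultimately have "finite D" "card D \<le> card (Pow {..<r - 1})"
    by (auto intro: inj_on_finite card_inj_on_le)
  then show ?thesis by (simp add: card_Pow)
qed

subsection \<open>Matrices modulo a prime acting on vectors\<close>

text \<open>Reduced residues and extensionality give each vector modulo \<open>p\<close> one
  representative in a finite set, so that bijectivity and kernel sizes become matters of
  counting.\<close>

definition vecs :: "nat \<Rightarrow> nat \<Rightarrow> (nat \<Rightarrow> int) set" where
  "vecs p n = {..<n} \<rightarrow>\<^sub>E {0..<int p}"

definition mat_act :: "nat \<Rightarrow> nat \<Rightarrow> (nat \<Rightarrow> nat \<Rightarrow> int) \<Rightarrow> (nat \<Rightarrow> int) \<Rightarrow> nat \<Rightarrow> int" where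
  "mat_act p n M v = (\<lambda>i\<in>{..<n}. (\<Sum>k<n. M i k * v k) mod int p)"

lemma finite_vecs [simp]: "finite (vecs p n)"
  unfolding vecs_def by (intro finite_PiE) auto

lemma mat_act_in_vecs: "0 < p \<Longrightarrow> mat_act p n M v \<in> vecs p n"
  unfolding vecs_def mat_act_def by auto

lemma mat_act_cong:
  assumes "\<And>i j. i < n \<Longrightarrow> j < n \<Longrightarrow> [M i j = M' i j] (mod int p)"
  shows "mat_act p n M v = mat_act p n M' v"
proof -
  have "[(\<Sum>k<n. M i k * v k) = (\<Sum>k<n. M' i k * v k)] (mod int p)" if "i < n" for i
    using assms that by (intro cong_sum cong_mult) auto
  then show ?thesis unfolding mat_act_def cong_def by (auto simp: restrict_def)
qed

lemma mat_act_one: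
  assumes "v \<in> vecs p n"
  shows "mat_act p n (\<lambda>i j. if i = j then 1 else 0) v = v"
proof
  fix i
  show "mat_act p n (\<lambda>i j. if i = j then 1 else 0) v i = v i"
  proof (cases "i < n")
    case True
    then have "(\<Sum>k<n. (if i = k then 1 else 0) * v k) = v i"
      by (simp add: if_distrib[of "\<lambda>x. x * _"] cong: if_cong)
    moreover have "v i mod int p = v i"
      using assms True unfolding vecs_def by (intro mod_pos_pos_trivial) (auto dest!: PiE_mem)
    ultimately show ?thesis using True by (simp add: mat_act_def)
  next
    case False
    then show ?thesis using assms PiE_arb[of v "{..<n}" "\<lambda>_. {0..<int p}" i]
      by (simp add: mat_act_def vecs_def)
  qed
qed

lemma mat_act_matmul: "mat_act p n M (mat_act p n M' v) = mat_act p n (matmul n M M') v"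
proof -
  have "(\<Sum>k<n. M i k * mat_act p n M' v k) mod int p = (\<Sum>k<n. matmul n M M' i k * v k) mod int p"
    if "i < n" for i
  proof -
    have "[(\<Sum>k<n. M i k * mat_act p n M' v k) = (\<Sum>k<n. M i k * (\<Sum>j<n. M' k j * v j))] (mod int p)"
      by (intro cong_sum cong_mult) (auto simp: mat_act_def)
    also have "(\<Sum>k<n. M i k * (\<Sum>j<n. M' k j * v j)) = (\<Sum>k<n. \<Sum>j<n. M i k * M' k j * v j)"
      by (simp add: sum_distrib_left mult.assoc)
    also have "\<dots> = (\<Sum>j<n. \<Sum>k<n. M i k * M' k j * v j)"
      by (rule sum.swap)
    also have "\<dots> = (\<Sum>k<n. matmul n M M' i k * v k)"
      by (simp add: matmul_def sum_distrib_right)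
    finally show ?thesis unfolding cong_def .
  qed
  then show ?thesis unfolding mat_act_def[of p n M] mat_act_def[of p n "matmul n M M'"]
    by (auto simp: restrict_def)
qed

lemma mat_act_inverse:
  assumes "\<And>i j. i < n \<Longrightarrow> j < n \<Longrightarrow> [matmul n M M' i j = (if i = j then 1 else 0)] (mod int p)"
    and "v \<in> vecs p n"
  shows "mat_act p n M (mat_act p n M' v) = v"
  using mat_act_cong[of n "matmul n M M'" "\<lambda>i j. if i = j then 1 else 0" p v] assms mat_act_one
  by (simp add: mat_act_matmul)

text \<open>\<open>similar_mod\<close> asks for a right inverse, while a spanning argument yields a
  left one. An injective self-map of the finite set \<open>vecs p n\<close> is surjective, and
  preimages of the unit vectors are the columns of \<open>R\<close>.\<close>

lemma left_inverse_imp_right_inverse_mod: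
  assumes p: "1 < p"
    and QP: "\<And>i j. i < n \<Longrightarrow> j < n \<Longrightarrow> [matmul n Q P i j = (if i = j then 1 else 0)] (mod int p)"
  shows "\<exists>R. \<forall>i<n. \<forall>j<n. [matmul n P R i j = (if i = j then 1 else 0)] (mod int p)"
proof -
  have "inj_on (mat_act p n P) (vecs p n)"
    by (rule inj_on_inverseI[where g = "mat_act p n Q"]) (rule mat_act_inverse[OF QP])
  then have surj: "mat_act p n P ` vecs p n = vecs p n"
    using p by (intro endo_inj_surj) (auto intro: mat_act_in_vecs)
  define e :: "nat \<Rightarrow> nat \<Rightarrow> int" where "e j = (\<lambda>i\<in>{..<n}. if i = j then 1 else 0)" for j
  have "e j \<in> vecs p n" for j using p unfolding e_def vecs_def by auto
  then have "\<forall>j. \<exists>q\<in>vecs p n. mat_act p n P q = e j" using surj by (metis imageE)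
  then obtain q where q: "\<And>j. mat_act p n P (q j) = e j" by metis
  have "[matmul n P (\<lambda>k j. q j k) i j = (if i = j then 1 else 0)] (mod int p)" if "i < n" for i j
    using fun_cong[OF q[of j], of i] that p
    by (auto simp: mat_act_def e_def matmul_def cong_def split: if_splits)
  then show ?thesis by blast
qed

subsection \<open>Uniqueness of the Jordan form\<close>

text \<open>The sizes of the kernels of the powers of \<open>A - 1\<close> on the finite space of vectors modulo \<open>p\<close>
  are similarity invariants that determine the block sizes.\<close>

definition minus_one :: "(nat \<Rightarrow> nat \<Rightarrow> int) \<Rightarrow> nat \<Rightarrow> nat \<Rightarrow> int" where
  "minus_one A i j = A i j - (if i = j then 1 else 0)"

definition ker_pow :: "nat \<Rightarrow> nat \<Rightarrow> (nat \<Rightarrow> nat \<Rightarrow> int) \<Rightarrow> nat \<Rightarrow> (nat \<Rightarrow> int) set" where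
  "ker_pow p n A k = {v \<in> vecs p n. (mat_act p n (minus_one A) ^^ k) v = (\<lambda>i\<in>{..<n}. 0)}"

text \<open>Having a right inverse, \<open>P\<close> acts surjectively and, by finiteness,
  bijectively. It intertwines \<open>A - 1\<close> with \<open>B - 1\<close>, so it maps the kernels
  of their powers onto each other.\<close>

lemma card_ker_pow_similar:
  assumes p: "0 < p" and sim: "similar_mod p n A B"
  shows "card (ker_pow p n A k) = card (ker_pow p n B k)"
proof -
  obtain P Q where
    PQ: "\<And>i j. i < n \<Longrightarrow> j < n \<Longrightarrow> [matmul n P Q i j = (if i = j then 1 else 0)] (mod int p)" and
    PA: "\<And>i j. i < n \<Longrightarrow> j < n \<Longrightarrow> [matmul n P A i j = matmul n B P i j] (mod int p)"
    using sim unfolding similar_mod_def by blast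
  let ?P = "mat_act p n P" and ?A = "mat_act p n (minus_one A)" and ?B = "mat_act p n (minus_one B)"
  let ?z = "\<lambda>i\<in>{..<n}. 0 :: int"
  have V: "mat_act p n M v \<in> vecs p n" for M v using p by (rule mat_act_in_vecs)
  have surj: "?P ` vecs p n = vecs p n"
  proof
    show "vecs p n \<subseteq> ?P ` vecs p n"
      using mat_act_inverse[OF PQ] V by (metis imageI subsetI)
  qed (use V in auto)
  then have inj: "inj_on ?P (vecs p n)"
    by (intro eq_card_imp_inj_on) auto
  have "matmul n P (minus_one A) i j = matmul n P A i j - P i j" if "j < n" for i j
    using that by (simp add: matmul_def minus_one_def algebra_simps sum_subtractf
        if_distrib[of "\<lambda>x. _ * x"] cong: if_cong)
  moreover have "matmul n (minus_one B) P i j = matmul n B P i j - P i j" if "i < n" for i j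
    using that by (simp add: matmul_def minus_one_def algebra_simps sum_subtractf
        if_distrib[of "\<lambda>x. _ * x"] cong: if_cong)
  ultimately have comm: "?P (?A v) = ?B (?P v)" for v
    unfolding mat_act_matmul using PA by (intro mat_act_cong) (auto intro: cong_diff)
  have comm_pow: "?P ((?A ^^ k) v) = (?B ^^ k) (?P v)" for v
    by (induction k) (auto simp: comm)
  have pow_V: "(?A ^^ k) v \<in> vecs p n" if "v \<in> vecs p n" for v
    using that by (induction k) (auto intro: V)
  have z: "?z \<in> vecs p n" "?P ?z = ?z" using p by (auto simp: vecs_def mat_act_def restrict_def split: if_splits)
  have "?P ` ker_pow p n A k = ker_pow p n B k"
  proof -
    have "(?B ^^ k) (?P v) = ?z \<longleftrightarrow> (?A ^^ k) v = ?z" if "v \<in> vecs p n" for v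
      using comm_pow[of v] z inj_onD[OF inj, of "(?A ^^ k) v" ?z] pow_V[OF that] by metis
    then have "ker_pow p n A k = {v \<in> vecs p n. (?B ^^ k) (?P v) = ?z}"
      unfolding ker_pow_def by blast
    moreover have "?P ` {v \<in> vecs p n. (?B ^^ k) (?P v) = ?z} = {w \<in> ?P ` vecs p n. (?B ^^ k) w = ?z}"
      by blast
    ultimately show ?thesis unfolding ker_pow_def surj by simp
  qed
  moreover have "inj_on ?P (ker_pow p n A k)"
    using inj by (rule inj_on_subset) (auto simp: ker_pow_def)
  ultimately show ?thesis by (metis card_image)
qed

section \<open>Positions inside the blocks of a direct sum\<close>

fun block_pos :: "nat list \<Rightarrow> nat \<Rightarrow> nat" where
  "block_pos [] i = 0"
| "block_pos (l # ls) i = (if i < l then i else block_pos ls (i - l))"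

text \<open>The number of indices after \<open>i\<close> in its block. The \<open>k\<close>-th power
  of the nilpotent part reads entry \<open>i + k\<close> if at least \<open>k\<close> of them
  remain, and gives 0 otherwise.\<close>

fun block_rest :: "nat list \<Rightarrow> nat \<Rightarrow> nat" where
  "block_rest [] i = 0"
| "block_rest (l # ls) i = (if i < l then l - Suc i else block_rest ls (i - l))"

lemma block_rest_less: "i < sum_list ls \<Longrightarrow> i + block_rest ls i < sum_list ls"
proof (induction ls arbitrary: i)
  case (Cons l ls)
  show ?case
  proof (cases "i < l")
    case False
    then have "i - l < sum_list ls" using Cons.prems by auto
    from Cons.IH[OF this] False show ?thesis by simp
  qed auto
qed simp

lemma block_rest_add:
  "i < sum_list ls \<Longrightarrow> k \<le> block_rest ls i \<Longrightarrow> block_rest ls (i + k) = block_rest ls i - k"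
proof (induction ls arbitrary: i)
  case (Cons l ls)
  show ?case
  proof (cases "i < l")
    case False
    then show ?thesis using Cons.IH[of "i - l"] Cons.prems by (auto simp: Nat.add_diff_assoc2)
  qed (use Cons.prems in auto)
qed simp

lemma block_pos_add:
  "i < sum_list ls \<Longrightarrow> k \<le> block_rest ls i \<Longrightarrow> block_pos ls (i + k) = block_pos ls i + k"
proof (induction ls arbitrary: i)
  case (Cons l ls)
  show ?case
  proof (cases "i < l")
    case False
    then show ?thesis using Cons.IH[of "i - l"] Cons.prems by (auto simp: Nat.add_diff_assoc2)
  qed (use Cons.prems in auto)
qed simp

lemma block_pos_le: "block_pos ls i \<le> i"
  by (induction ls arbitrary: i) (auto intro: le_trans diff_le_self)

lemma block_rest_diff:
  "i < sum_list ls \<Longrightarrow> k \<le> block_pos ls i \<Longrightarrow> k \<le> block_rest ls (i - k)"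
proof (induction ls arbitrary: i)
  case (Cons l ls)
  show ?case
  proof (cases "i < l")
    case False
    have "k \<le> i - l" using Cons.prems False block_pos_le[of ls "i - l"] by auto
    then show ?thesis using Cons.IH[of "i - l"] Cons.prems False
      by (auto simp: add.commute)
  qed (use Cons.prems in auto)
qed simp

lemma jordan_sum_row:
  fixes u :: "nat \<Rightarrow> int"
  assumes "i < sum_list ls"
  shows "(\<Sum>j<sum_list ls. jordan_sum ls i j * u j) =
     u i + (if 0 < block_rest ls i then u (Suc i) else 0)"
  using assms
proof (induction ls arbitrary: i u)
  case (Cons l ls)
  have split: "(\<Sum>j<sum_list (l # ls). f j) = (\<Sum>j<l. f j) + (\<Sum>j<sum_list ls. f (l + j))"
    for f :: "nat \<Rightarrow> int"
  proof -
    have "(\<Sum>j<l + m. f j) = (\<Sum>j<l. f j) + (\<Sum>j<m. f (l + j))" for m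
      by (induction m) auto
    then show ?thesis by simp
  qed
  show ?case
  proof (cases "i < l")
    case True
    have "(\<Sum>j<l. Jmat l i j * u j) = (\<Sum>j<l. (if j = i then u j else 0) + (if j = Suc i then u j else 0))"
      using True by (intro sum.cong) (auto simp: Jmat_def)
    also have "\<dots> = u i + (if Suc i < l then u (Suc i) else 0)"
      using True by (simp add: sum.distrib)
    finally show ?thesis unfolding split using True by simp
  next
    case False
    have "(\<Sum>j<sum_list ls. jordan_sum ls (i - l) j * u (l + j)) =
      u i + (if 0 < block_rest ls (i - l) then u (Suc i) else 0)"
      using Cons.IH[of "i - l" "\<lambda>j. u (l + j)"] Cons.prems False by simp
    then show ?thesis unfolding split using False by simp
  qed
qed simp

lemma card_block_pos_less:
  "card {i. i < sum_list ls \<and> block_pos ls i < k} = (\<Sum>l\<leftarrow>ls. min l k)"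
proof (induction ls)
  case (Cons l ls)
  have "{i. i < sum_list (l # ls) \<and> block_pos (l # ls) i < k} =
    {..<min l k} \<union> (\<lambda>i. l + i) ` {i. i < sum_list ls \<and> block_pos ls i < k}"
  proof (intro equalityI subsetI)
    fix i assume i: "i \<in> {i. i < sum_list (l # ls) \<and> block_pos (l # ls) i < k}"
    show "i \<in> {..<min l k} \<union> (\<lambda>i. l + i) ` {i. i < sum_list ls \<and> block_pos ls i < k}"
    proof (cases "i < l")
      case False
      then have "i = l + (i - l)" by simp
      then show ?thesis using i False by (intro UnI2 image_eqI[of _ _ "i - l"]) auto
    qed (use i in auto)
  qed auto
  also have "card \<dots> = min l k + card {i. i < sum_list ls \<and> block_pos ls i < k}"
    by (subst card_Un_disjoint) (auto simp: card_image)
  finally show ?case using Cons.IH by simp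
qed simp

text \<open>The \<open>k\<close>-th power of the nilpotent part shifts entries by \<open>k\<close>
  inside each block, so its kernel consists of the vectors that vanish at block positions from
  \<open>k\<close> on; the other entries are free.\<close>

lemma card_ker_pow_jordan_sum:
  assumes p: "0 < p" and n: "n = sum_list ls"
  shows "card (ker_pow p n (jordan_sum ls) k) = p ^ (\<Sum>l\<leftarrow>ls. min l k)"
proof -
  let ?N = "mat_act p n (minus_one (jordan_sum ls))"
  have N: "?N v i = (if 0 < block_rest ls i then v (Suc i) mod int p else 0)" if "i < n" for v i
  proof -
    have "(\<Sum>j<n. minus_one (jordan_sum ls) i j * v j) =
       (\<Sum>j<n. jordan_sum ls i j * v j) - v i"
      using that by (simp add: minus_one_def algebra_simps sum_subtractf
        if_distrib[of "\<lambda>x. _ * x"] cong: if_cong)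
    then show ?thesis using that jordan_sum_row[of i ls v] n by (simp add: mat_act_def)
  qed
  have pow: "(?N ^^ k) v i = (if k \<le> block_rest ls i then v (i + k) else 0)"
    if "v \<in> vecs p n" "i < n" for v i k
    using that(2)
  proof (induction k arbitrary: i)
    case (Suc k)
    show ?case
    proof (cases "0 < block_rest ls i")
      case True
      then have lt: "Suc i < n" using block_rest_less[of i ls] Suc.prems n by simp
      have br: "block_rest ls (Suc i) = block_rest ls i - 1"
        using block_rest_add[of i ls 1] True Suc.prems n by simp
      have "v (Suc (i + k)) mod int p = v (Suc (i + k))" if "k \<le> block_rest ls (Suc i)"
        using \<open>v \<in> vecs p n\<close> block_rest_less[of "Suc i" ls] that lt n unfolding vecs_def
        by (intro mod_pos_pos_trivial) (auto dest!: PiE_mem[of v _ _ "Suc (i + k)"])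
      then show ?thesis using N[OF Suc.prems] Suc.IH[OF lt] br True by auto
    qed (use N[OF Suc.prems] in auto)
  qed simp
  have ext: "v = (\<lambda>i\<in>{..<n}. 0) \<longleftrightarrow> (\<forall>i<n. v i = 0)" if "v \<in> vecs p n" for v :: "nat \<Rightarrow> int"
    using that by (auto simp: vecs_def fun_eq_iff PiE_def extensional_def)
  have pow_V: "(?N ^^ k) v \<in> vecs p n" if "v \<in> vecs p n" for v
    using that by (induction k) (auto intro: mat_act_in_vecs[OF p])
  \<comment> \<open>Reindexing by \<open>j = i + k\<close>: having \<open>k\<close> successors of
    \<open>i\<close> in its block amounts to having \<open>k\<close> predecessors of
    \<open>j\<close>.\<close>
  have zero: "(\<forall>i<n. k \<le> block_rest ls i \<longrightarrow> v (i + k) = 0) \<longleftrightarrow> (\<forall>j<n. k \<le> block_pos ls j \<longrightarrow> v j = 0)"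
    for v :: "nat \<Rightarrow> int"
  proof safe
    fix j assume *: "\<forall>i<n. k \<le> block_rest ls i \<longrightarrow> v (i + k) = 0" "j < n" "k \<le> block_pos ls j"
    then have "k \<le> j" using block_pos_le[of ls j] by simp
    then show "v j = 0" using *(1)[rule_format, of "j - k"] * block_rest_diff[of j ls k] n by auto
  next
    fix i assume *: "\<forall>j<n. k \<le> block_pos ls j \<longrightarrow> v j = 0" "i < n" "k \<le> block_rest ls i"
    then show "v (i + k) = 0"
      using block_rest_less[of i ls] block_pos_add[of i ls k] n by auto
  qed
  have "ker_pow p n (jordan_sum ls) k =
    (\<Pi>\<^sub>E i\<in>{..<n}. if block_pos ls i < k then {0..<int p} else {0})" (is "_ = ?R")
  proof -
    have "(?N ^^ k) v = (\<lambda>i\<in>{..<n}. 0) \<longleftrightarrow> (\<forall>i<n. k \<le> block_rest ls i \<longrightarrow> v (i + k) = 0)"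
      if "v \<in> vecs p n" for v
      using ext[OF pow_V[OF that]] pow[OF that] by auto
    then have "v \<in> ker_pow p n (jordan_sum ls) k \<longleftrightarrow>
      v \<in> vecs p n \<and> (\<forall>j<n. k \<le> block_pos ls j \<longrightarrow> v j = 0)" for v
      unfolding ker_pow_def zero by blast
    moreover have "v \<in> vecs p n \<and> (\<forall>j<n. k \<le> block_pos ls j \<longrightarrow> v j = 0) \<longleftrightarrow> v \<in> ?R" for v
    proof -
      have "v j \<in> {0..<int p} \<and> (k \<le> block_pos ls j \<longrightarrow> v j = 0) \<longleftrightarrow>
        v j \<in> (if block_pos ls j < k then {0..<int p} else {0})" for j
        using p by auto
      then show ?thesis unfolding vecs_def PiE_iff Ball_def lessThan_iff by blast
    qed
    ultimately show ?thesis by blast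
  qed
  then have "card (ker_pow p n (jordan_sum ls) k) = (\<Prod>i<n. if block_pos ls i < k then p else 1)"
    by (simp add: card_PiE if_distrib[of card] cong: if_cong)
  also have "\<dots> = (\<Prod>i\<in>{i. i < n \<and> block_pos ls i < k}. p)"
    by (intro prod.mono_neutral_cong_right) auto
  also have "\<dots> = p ^ (\<Sum>l\<leftarrow>ls. min l k)" unfolding n prod_constant card_block_pos_less ..
  finally show ?thesis .
qed

text \<open>A second difference: passing from \<open>k\<close> to \<open>Suc k\<close> adds the
  number of parts above \<open>k\<close>, and two consecutive such counts differ by the multiplicity
  of \<open>Suc k\<close>.\<close>

lemma partition_eqI:
  fixes xs ys :: "nat list"
  assumes xs: "sorted_wrt (\<ge>) xs" "\<forall>x\<in>set xs. 0 < x"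
    and ys: "sorted_wrt (\<ge>) ys" "\<forall>x\<in>set ys. 0 < x"
    and eq: "\<And>k. (\<Sum>l\<leftarrow>xs. min l k) = (\<Sum>l\<leftarrow>ys. min l k)"
  shows "xs = ys"
proof -
  have step: "(\<Sum>l\<leftarrow>zs. min l (Suc k)) = (\<Sum>l\<leftarrow>zs. min l k) + size (filter_mset ((<) k) (mset zs))"
    for zs k by (induction zs) auto
  have gt: "size (filter_mset ((<) k) (mset xs)) = size (filter_mset ((<) k) (mset ys))" for k
    using step[of k xs] step[of k ys] eq[of k] eq[of "Suc k"] by simp
  have cnt: "size (filter_mset ((<) k) M) = size (filter_mset ((<) (Suc k)) M) + count M (Suc k)"
    for k and M :: "nat multiset" by (induction M) auto
  have "count (mset xs) k = count (mset ys) k" for k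
  proof (cases k)
    case 0
    then show ?thesis using xs(2) ys(2) by (metis count_mset_0_iff less_irrefl)
  next
    case (Suc k')
    then show ?thesis using cnt[of k' "mset xs"] cnt[of k' "mset ys"] gt[of k'] gt[of "Suc k'"] by simp
  qed
  then have "mset (rev xs) = mset (rev ys)" by (auto intro: multiset_eqI)
  moreover have "sorted (rev xs)" "sorted (rev ys)" using xs(1) ys(1) by (auto simp: sorted_wrt_rev)
  ultimately have "rev xs = rev ys" by (metis properties_for_sort)
  then show ?thesis by simp
qed

lemma jordan_form_unique:
  assumes p: "1 < p"
    and xs: "sorted_wrt (\<ge>) xs" "\<forall>x\<in>set xs. 0 < x" "sum_list xs = n" "similar_mod p n A (jordan_sum xs)"
    and ys: "sorted_wrt (\<ge>) ys" "\<forall>x\<in>set ys. 0 < x" "sum_list ys = n" "similar_mod p n A (jordan_sum ys)"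
  shows "xs = ys"
proof (rule partition_eqI[OF xs(1,2) ys(1,2)])
  fix k
  have "p ^ (\<Sum>l\<leftarrow>xs. min l k) = p ^ (\<Sum>l\<leftarrow>ys. min l k)"
    using card_ker_pow_similar[of p n A _ k] card_ker_pow_jordan_sum[of p n _ k] p xs(3,4) ys(3,4)
    by (metis less_trans zero_less_one)
  then show "(\<Sum>l\<leftarrow>xs. min l k) = (\<Sum>l\<leftarrow>ys. min l k)" using p by simp
qed

subsection \<open>Homogeneous forms and the coordinate ring\<close>

text \<open>The form \<open>z ^ n * f (x / z)\<close>; coefficients of \<open>f\<close> beyond
  \<open>n\<close> are dropped.\<close>

definition homogenize :: "'a::comm_ring_1 \<Rightarrow> 'a \<Rightarrow> nat \<Rightarrow> int poly \<Rightarrow> 'a" where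
  "homogenize x z n f = (\<Sum>i\<le>n. of_int (coeff f i) * x ^ i * z ^ (n - i))"

lemma homogenize_diff: "homogenize x z n (f - g) = homogenize x z n f - homogenize x z n g"
  by (simp add: homogenize_def algebra_simps sum_subtractf)

lemma homogenize_extend:
  assumes "\<And>i. a < i \<Longrightarrow> coeff f i = 0" and "a \<le> n"
  shows "homogenize x z n f = z ^ (n - a) * homogenize x z a f"
proof -
  have "homogenize x z n f = (\<Sum>i\<le>a. of_int (coeff f i) * x ^ i * z ^ (n - i))"
    unfolding homogenize_def using assms by (intro sum.mono_neutral_right) auto
  also have "\<dots> = (\<Sum>i\<le>a. z ^ (n - a) * (of_int (coeff f i) * x ^ i * z ^ (a - i)))"
    using assms(2) by (intro sum.cong) (auto simp: mult_ac simp flip: power_add)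
  finally show ?thesis by (simp add: homogenize_def sum_distrib_left)
qed

lemma homogenize_mult_one_minus:
  assumes "\<And>i. n < i \<Longrightarrow> coeff f i = 0"
  shows "homogenize x z (Suc n) ([:1, -1:] * f) = (z - x) * homogenize x z n f"
proof -
  have eq: "[:1, -1:] * f = f - pCons 0 f" by simp
  have "homogenize x z (Suc n) f = z * homogenize x z n f"
    using homogenize_extend[of n f "Suc n" x z] assms by simp
  moreover have "homogenize x z (Suc n) (pCons 0 f) = x * homogenize x z n f"
    unfolding homogenize_def
    by (subst sum.atMost_Suc_shift) (simp add: sum_distrib_left mult_ac)
  ultimately show ?thesis unfolding eq homogenize_diff by (simp only: left_diff_distrib)
qed

text \<open>\<open>1 - X\<close> homogenizes to \<open>z - x\<close>. The induction carries the
  degree bound along, because \<open>homogenize\<close> would cut off higher coefficients.\<close>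

lemma homogenize_mult_one_minus_power:
  assumes "\<And>i. n < i \<Longrightarrow> coeff f i = 0"
  shows "homogenize x z (n + s) ([:1, -1:] ^ s * f) = (z - x) ^ s * homogenize x z n f"
proof -
  have "(\<forall>i>n + s. coeff ([:1, -1:] ^ s * f) i = 0) \<and>
    homogenize x z (n + s) ([:1, -1:] ^ s * f) = (z - x) ^ s * homogenize x z n f"
  proof (induction s)
    case (Suc s)
    let ?h = "[:1, -1:] ^ s * f"
    have "coeff ([:1, -1:] * ?h) i = 0" if "n + Suc s < i" for i
      using that Suc.IH by (cases i) (auto simp: coeff_pCons)
    moreover have "[:1, -1:] ^ Suc s * f = [:1, -1:] * ?h" by (simp only: power_Suc mult.assoc)
    moreover have "homogenize x z (Suc (n + s)) ([:1, -1:] * ?h) = (z - x) * homogenize x z (n + s) ?h"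
      using Suc.IH by (intro homogenize_mult_one_minus) blast
    ultimately show ?case using Suc.IH by (simp only: add_Suc_right power_Suc mult.assoc) blast
  qed (use assms in simp)
  then show ?thesis by blast
qed

text \<open>An element of \<open>\<int>[x][y]\<close> is a polynomial in \<open>y\<close> (outer) over polynomials in \<open>x\<close> (inner);
  \<open>coeff2 f i k\<close> is the coefficient of \<open>x\<^sup>i y\<^sup>k\<close>, which becomes the entry \<open>i * s + k\<close> of a row vector of
  length \<open>r * s\<close>.\<close>

definition coeff2 :: "int poly poly \<Rightarrow> nat \<Rightarrow> nat \<Rightarrow> int" where
  "coeff2 f i k = coeff (coeff f k) i"

definition var_x :: "int poly poly" where "var_x = [:[:0, 1:]:]"
definition var_y :: "int poly poly" where "var_y = [:0, 1:]"

lemma coeff2_simps [simp]: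
  "coeff2 0 i k = 0"
  "coeff2 (f + g) i k = coeff2 f i k + coeff2 g i k"
  "coeff2 (f - g) i k = coeff2 f i k - coeff2 g i k"
  "coeff2 (of_int c * f) i k = c * coeff2 f i k"
  by (simp_all add: coeff2_def of_int_poly)

lemma coeff2_sum: "coeff2 (sum f A) i k = (\<Sum>a\<in>A. coeff2 (f a) i k)"
  by (simp add: coeff2_def coeff_sum)

lemma coeff2_var_x_mult: "coeff2 (var_x * f) i k = (if i = 0 then 0 else coeff2 f (i - 1) k)"
  by (simp add: coeff2_def var_x_def coeff_pCons split: nat.split)

lemma coeff2_var_y_mult: "coeff2 (var_y * f) i k = (if k = 0 then 0 else coeff2 f i (k - 1))"
  by (simp add: coeff2_def var_y_def coeff_pCons split: nat.split)

lemma coeff2_var_x_power_mult: "coeff2 (var_x ^ n * f) i k = (if i < n then 0 else coeff2 f (i - n) k)"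
  by (induction n arbitrary: i) (auto simp: coeff2_var_x_mult mult.assoc)

lemma coeff2_var_y_power_mult: "coeff2 (var_y ^ n * f) i k = (if k < n then 0 else coeff2 f i (k - n))"
  by (induction n arbitrary: k) (auto simp: coeff2_var_y_mult mult.assoc)

lemma coeff2_monomial:
  "coeff2 (var_x ^ a * var_y ^ b) i k = (if i = a \<and> k = b then 1 else 0)"
proof -
  have "coeff2 (var_x ^ a * (var_y ^ b * 1)) i k = (if i = a \<and> k = b then 1 else 0)"
    unfolding coeff2_var_x_power_mult coeff2_var_y_power_mult
    by (auto simp: coeff2_def)
  then show ?thesis by simp
qed

text \<open>Acting on a row vector, \<open>Jmat\<close> adds to each entry its predecessor, which is
  multiplication by one plus the variable. Only lower exponents enter a coefficient, so truncation
  to \<open>r * s\<close> entries does no harm.\<close>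

lemma coeff2_mult_kron:
  assumes j: "j < r * s"
  shows "(\<Sum>l<r * s. coeff2 f (l div s) (l mod s) * kron r s (Jmat r) (Jmat s) l j) =
    coeff2 ((1 + var_x) * (1 + var_y) * f) (j div s) (j mod s)"
proof -
  have s: "0 < s" using j by (cases s) auto
  have jr: "j div s < r" using j s by (simp add: less_mult_imp_div_less)
  have js: "j mod s < s" using s by simp
  have J: "(\<Sum>i<n. u i * Jmat n i i') = u i' + (if i' = 0 then 0 else u (i' - 1))"
    if "i' < n" for u n i'
  proof -
    \<comment> \<open>For \<open>i' = 0\<close> natural subtraction makes \<open>i' - 1\<close> zero
      as well; the inner test removes the spurious second term.\<close>
    have "(\<Sum>i<n. u i * Jmat n i i') =
      (\<Sum>i<n. (if i = i' then u i else 0) + (if i = i' - 1 then if i' = 0 then 0 else u i else 0))"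
      using that by (intro sum.cong) (auto simp: Jmat_def)
    also have "\<dots> = u i' + (if i' = 0 then 0 else u (i' - 1))"
      using that by (simp add: sum.distrib)
    finally show ?thesis .
  qed
  have "(\<Sum>l<r * s. coeff2 f (l div s) (l mod s) * kron r s (Jmat r) (Jmat s) l j) =
    (\<Sum>i<r. \<Sum>l\<in>{i * s..<i * s + s}. coeff2 f (l div s) (l mod s) * kron r s (Jmat r) (Jmat s) l j)"
    by (rule sum.nat_group[symmetric])
  also have "\<dots> = (\<Sum>i<r. \<Sum>k<s. coeff2 f i k * (Jmat r i (j div s) * Jmat s k (j mod s)))"
  proof (rule sum.cong[OF refl])
    fix i assume i: "i \<in> {..<r}"
    have lt: "k + i * s < r * s" if "k < s" for k
    proof -
      have "k + i * s < Suc i * s" using that by simp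
      also have "\<dots> \<le> r * s" using i by (intro mult_right_mono) auto
      finally show ?thesis .
    qed
    have "(\<Sum>l\<in>{0 + i * s..<s + i * s}. coeff2 f (l div s) (l mod s) * kron r s (Jmat r) (Jmat s) l j) =
      (\<Sum>k\<in>{0..<s}. coeff2 f i k * (Jmat r i (j div s) * Jmat s k (j mod s)))"
      unfolding sum.shift_bounds_nat_ivl
      using lt j by (intro sum.cong refl) (auto simp: kron_def)
    then show "(\<Sum>l\<in>{i * s..<i * s + s}. coeff2 f (l div s) (l mod s) * kron r s (Jmat r) (Jmat s) l j) =
      (\<Sum>k<s. coeff2 f i k * (Jmat r i (j div s) * Jmat s k (j mod s)))"
      by (simp add: add.commute lessThan_atLeast0)
  qed
  also have "\<dots> = (\<Sum>i<r. (\<Sum>k<s. coeff2 f i k * Jmat s k (j mod s)) * Jmat r i (j div s))"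
    by (simp add: sum_distrib_left sum_distrib_right mult_ac)
  also have "\<dots> = (\<Sum>i<r. coeff2 ((1 + var_y) * f) i (j mod s) * Jmat r i (j div s))"
    unfolding J[OF js] by (simp add: ring_distribs coeff2_var_y_mult)
  also have "\<dots> = coeff2 ((1 + var_x) * ((1 + var_y) * f)) (j div s) (j mod s)"
    unfolding J[OF jr] ring_distribs(2)[of 1 var_x] by (simp add: coeff2_var_x_mult)
  finally show ?thesis by (simp add: mult.assoc)
qed

text \<open>The ideal \<open>(p, x\<^sup>r, y\<^sup>s)\<close>.\<close>

definition null_ideal :: "nat \<Rightarrow> nat \<Rightarrow> nat \<Rightarrow> int poly poly set" where
  "null_ideal r s p = {f. \<forall>i<r. \<forall>k<s. int p dvd coeff2 f i k}"

lemma null_ideal_closed: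
  shows null_ideal_0: "0 \<in> null_ideal r s p"
    and null_ideal_add: "f \<in> null_ideal r s p \<Longrightarrow> g \<in> null_ideal r s p \<Longrightarrow> f + g \<in> null_ideal r s p"
  by (auto simp: null_ideal_def)

lemma null_ideal_sum:
  "(\<And>a. a \<in> A \<Longrightarrow> f a \<in> null_ideal r s p) \<Longrightarrow> sum f A \<in> null_ideal r s p"
  by (induction A rule: infinite_finite_induct) (auto intro: null_ideal_closed)

lemma null_ideal_mult:
  assumes "f \<in> null_ideal r s p"
  shows "g * f \<in> null_ideal r s p"
proof -
  have "int p dvd coeff2 (g * f) i k" if "i < r" "k < s" for i k
  proof -
    have "coeff2 (g * f) i k =
      (\<Sum>l\<le>k. \<Sum>j\<le>i. coeff (coeff g l) j * coeff2 f (i - j) (k - l))"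
      by (simp add: coeff2_def coeff_mult coeff_sum)
    also have "int p dvd \<dots>"
      using assms that by (intro dvd_sum dvd_mult) (auto simp: null_ideal_def)
    finally show ?thesis .
  qed
  then show ?thesis by (simp add: null_ideal_def)
qed

lemma null_ideal_generators:
  shows null_ideal_var_x_power: "r \<le> a \<Longrightarrow> var_x ^ a * f \<in> null_ideal r s p"
    and null_ideal_var_y_power: "var_y ^ s * f \<in> null_ideal r s p"
    and null_ideal_of_int: "int p dvd c \<Longrightarrow> of_int c * f \<in> null_ideal r s p"
  by (auto simp: null_ideal_def coeff2_var_x_power_mult coeff2_var_y_power_mult)

text \<open>Reads an index of concatenated chains as a chain \<open>a\<close> and a place
  \<open>k\<close> in it, with the successor known wherever \<open>jordan_sum\<close> has a
  superdiagonal 1.\<close>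

lemma nth_concat_chains:
  assumes "i < length (concat (map (\<lambda>a. map (h a) [0..<l a]) as))"
    (is "i < length ?L")
  shows "\<exists>a\<in>set as. \<exists>k<l a. ?L ! i = h a k \<and> block_rest (map l as) i = l a - Suc k \<and>
    (Suc k < l a \<longrightarrow> ?L ! Suc i = h a (Suc k))"
  using assms
proof (induction as arbitrary: i)
  case (Cons b as)
  show ?case
  proof (cases "i < l b")
    case True
    then show ?thesis by (intro bexI[of _ b] exI[of _ i]) (auto simp: nth_append)
  next
    case False
    then show ?thesis using Cons.IH[of "i - l b"] Cons.prems
      by (auto simp: nth_append Suc_diff_le)
  qed
qed simp

subsection \<open>The Jordan basis\<close>

locale jordan_tensor =
  fixes r s p :: nat
  assumes prime_p: "prime p" and r_le_s: "r \<le> s"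
begin

abbreviation "zz \<equiv> (1 + var_x) * (1 + var_y) - 1"
abbreviation "I \<equiv> null_ideal r s p"

text \<open>The congruence \<open>g \<equiv> (1 - X)\<^sup>s b\<close> modulo \<open>(p, X\<^sup>r)\<close>, with \<open>deg g = a\<close> and \<open>deg b < m\<close>, says after
  homogenization in \<open>(x, zz)\<close> that \<open>zz\<close> to the power \<open>s + m - 1 - a\<close> kills the form of degree \<open>a\<close>
  belonging to \<open>g\<close>, because \<open>(zz - x)\<^sup>s = y\<^sup>s (1 + x)\<^sup>s\<close> lies in the ideal.\<close>

definition annihilates :: "nat \<Rightarrow> nat \<Rightarrow> int poly \<Rightarrow> int poly \<Rightarrow> bool" where
  "annihilates a m g b \<longleftrightarrow> (\<forall>i>a. coeff g i = 0) \<and> \<not> int p dvd coeff g a \<and>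
     (\<forall>i\<ge>m. coeff b i = 0) \<and> (\<forall>i<r. int p dvd coeff (g - [:1, -1:] ^ s * b) i)"

definition ht :: "nat \<Rightarrow> nat" where
  "ht a = (LEAST m. \<exists>g b. annihilates a m g b)"

text \<open>\<open>1 - X\<close> is a unit modulo \<open>X ^ r\<close>, with the geometric sum
  \<open>e\<close> as inverse. So take \<open>g = X ^ a\<close>, and for \<open>b\<close> the
  quotient of \<open>X ^ a\<close> by \<open>(1 - X) ^ s\<close>, cut off at degree
  \<open>r\<close>.\<close>

lemma annihilates_exists:
  assumes "a < r"
  shows "\<exists>g b. annihilates a r g b"
proof -
  have inv: "\<exists>t. monom 1 r dvd ([:1, -1:] ^ n * t - 1 :: int poly)" for n
  proof (induction n)
    case 0
    show ?case by (intro exI[of _ 1]) simp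
  next
    case (Suc n)
    then obtain t :: "int poly" where t: "monom 1 r dvd [:1, -1:] ^ n * t - 1" by blast
    define e :: "int poly" where "e = (\<Sum>i<r. monom 1 i)"
    have "[:1, -1:] * e = 1 - monom 1 r"
    proof -
      have "[:1, -1:] * (\<Sum>i<k. monom 1 i) = 1 - (monom 1 k :: int poly)" for k
      proof (induction k)
        case (Suc k)
        have "[:1, -1:] * monom 1 k = monom 1 k - (monom 1 (Suc k) :: int poly)"
          by (simp add: monom_Suc)
        with Suc show ?case by (simp only: sum.lessThan_Suc distrib_left)
      qed simp
      then show ?thesis unfolding e_def .
    qed
    moreover have "u ^ Suc n * (t * e) - 1 = (u ^ n * t - 1) - monom 1 r * (u ^ n * t)"
      if "u * e = 1 - monom 1 r" for u
    proof -
      have "u ^ Suc n * (t * e) = (u ^ n * t) * (u * e)" by (simp only: power_Suc mult_ac)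
      then show ?thesis unfolding that by (simp add: algebra_simps)
    qed
    ultimately have "[:1, -1:] ^ Suc n * (t * e) - 1 =
      ([:1, -1:] ^ n * t - 1) - monom 1 r * ([:1, -1:] ^ n * t)" by blast
    with t show ?case by (intro exI[of _ "t * e"]) (metis dvd_diff dvd_triv_left)
  qed
  obtain t :: "int poly" where t: "monom 1 r dvd [:1, -1:] ^ s * t - 1" using inv by blast
  define c where "c = t * monom 1 a"
  define b where "b = poly_cutoff r c"
  have cb: "monom 1 r dvd c - b"
    unfolding monom_1_dvd_iff' by (auto simp: b_def coeff_poly_cutoff)
  have "monom 1 r dvd [:1, -1:] ^ s * (c - b) - ([:1, -1:] ^ s * t - 1) * monom 1 a"
    by (rule dvd_diff[OF dvd_mult[OF cb] dvd_mult2[OF t]])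
  moreover have "[:1, -1:] ^ s * (c - b) - ([:1, -1:] ^ s * t - 1) * monom 1 a =
    monom 1 a - [:1, -1:] ^ s * b"
    by (simp add: c_def algebra_simps)
  ultimately have "\<forall>i<r. coeff (monom 1 a - [:1, -1:] ^ s * b) i = 0"
    unfolding monom_1_dvd_iff'[symmetric] by simp
  moreover have "\<forall>i\<ge>r. coeff b i = 0" by (simp add: b_def coeff_poly_cutoff)
  moreover have "\<not> int p dvd 1" using prime_p by (auto dest: prime_gt_1_nat)
  ultimately have "annihilates a r (monom 1 a) b"
    unfolding annihilates_def by auto
  then show ?thesis by blast
qed

lemma ht_le: "annihilates a m g b \<Longrightarrow> ht a \<le> m"
  unfolding ht_def by (rule Least_le) blast

lemma ht_le_r: "a < r \<Longrightarrow> ht a \<le> r"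
  using annihilates_exists ht_le by blast

lemma annihilates_ht: "a < r \<Longrightarrow> \<exists>g b. annihilates a (ht a) g b"
  unfolding ht_def using annihilates_exists by (rule LeastI_ex[OF exI])

lemma ht_pos:
  assumes a: "a < r"
  shows "0 < ht a"
proof (rule ccontr)
  assume "\<not> 0 < ht a"
  then obtain g b where gb: "annihilates a 0 g b" using annihilates_ht[OF a] by auto
  then have "b = 0" by (auto simp: annihilates_def intro: poly_eqI)
  with gb a show False by (auto simp: annihilates_def)
qed

lemma ht_Suc_le:
  assumes a: "Suc a < r"
  shows "ht (Suc a) \<le> Suc (ht a)"
proof -
  obtain g b where gb: "annihilates a (ht a) g b" using annihilates_ht[of a] a by auto
  have "pCons 0 g - [:1, -1:] ^ s * pCons 0 b = pCons 0 (g - [:1, -1:] ^ s * b)"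
    by simp
  then have "annihilates (Suc a) (Suc (ht a)) (pCons 0 g) (pCons 0 b)"
    using gb unfolding annihilates_def by (auto simp: coeff_pCons split: nat.split)
  then show ?thesis by (rule ht_le)
qed

text \<open>Otherwise dropping the top term of \<open>b\<close> would preserve the congruence and
  lower the height.\<close>

lemma lead_coeff_ht:
  assumes a: "a < r" and gb: "annihilates a (ht a) g b"
  shows "\<not> int p dvd coeff b (ht a - 1)"
proof
  assume p: "int p dvd coeff b (ht a - 1)"
  define b' where "b' = b - monom (coeff b (ht a - 1)) (ht a - 1)"
  have "int p dvd coeff (g - [:1, -1:] ^ s * b') i" if "i < r" for i
  proof -
    have "g - [:1, -1:] ^ s * b' = (g - [:1, -1:] ^ s * b) +
      [:1, -1:] ^ s * monom (coeff b (ht a - 1)) (ht a - 1)"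
      by (simp add: b'_def algebra_simps)
    moreover have "int p dvd coeff ([:1, -1:] ^ s * monom (coeff b (ht a - 1)) (ht a - 1)) i"
      unfolding coeff_mult using p by (intro dvd_sum dvd_mult) auto
    moreover have "int p dvd coeff (g - [:1, -1:] ^ s * b) i"
      using gb that unfolding annihilates_def by blast
    ultimately show ?thesis by (simp only: coeff_add dvd_add)
  qed
  moreover have "coeff b' i = 0" if "ht a - 1 \<le> i" for i
    using gb that by (cases "i = ht a - 1") (auto simp: b'_def annihilates_def)
  ultimately have "annihilates a (ht a - 1) g b'"
    using gb by (auto simp: annihilates_def)
  then show False using ht_le[of a "ht a - 1" g b'] ht_pos[OF a] by simp
qed

text \<open>If two heights agree, cancelling the leading terms of the two \<open>b\<close>'s lowers the second height.\<close>

lemma ht_neq: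
  assumes ab: "a < a'" "a' < r"
  shows "ht a \<noteq> ht a'"
proof
  assume eq: "ht a = ht a'"
  have a: "a < r" using ab by simp
  obtain g b where gb: "annihilates a (ht a) g b" using annihilates_ht[OF a] by blast
  obtain g' b' where gb': "annihilates a' (ht a) g' b'" using annihilates_ht[OF ab(2)] eq by auto
  define u v where "u = coeff b (ht a - 1)" and "v = coeff b' (ht a - 1)"
  have u: "\<not> int p dvd u" using lead_coeff_ht[OF a gb] by (simp add: u_def)
  \<comment> \<open>The terms of \<open>b''\<close> in degree \<open>ht a - 1\<close> cancel. At
    \<open>a'\<close> the coefficient of \<open>g''\<close> is \<open>u\<close> times that of
    \<open>g'\<close>, since \<open>g\<close> stops at \<open>a < a'\<close>; neither factor is
    divisible by \<open>p\<close>.\<close>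
  define g'' b'' where "g'' = smult u g' - smult v g" and "b'' = smult u b' - smult v b"
  have "int p dvd coeff (g'' - [:1, -1:] ^ s * b'') i" if "i < r" for i
  proof -
    have "g'' - [:1, -1:] ^ s * b'' =
      smult u (g' - [:1, -1:] ^ s * b') - smult v (g - [:1, -1:] ^ s * b)"
      by (simp add: g''_def b''_def algebra_simps smult_diff_right)
    then show ?thesis using gb gb' that
      by (simp add: annihilates_def del: coeff_diff add: coeff_diff[of "smult _ _"])
  qed
  moreover have "coeff b'' i = 0" if "ht a - 1 \<le> i" for i
    using gb gb' that
    by (cases "i = ht a - 1") (auto simp: b''_def u_def v_def annihilates_def)
  moreover have "\<not> int p dvd coeff g'' a'"
    using gb gb' ab u prime_p
    by (auto simp: g''_def annihilates_def prime_dvd_mult_iff)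
  moreover have "\<forall>i>a'. coeff g'' i = 0"
    using gb gb' ab by (auto simp: g''_def annihilates_def)
  ultimately have "annihilates a' (ht a - 1) g'' b''" by (auto simp: annihilates_def)
  then show False using ht_le[of a' "ht a - 1" g'' b''] ht_pos[OF a] eq by simp
qed

lemma slow_perm_ht: "slow_perm r ht"
proof -
  have "inj_on ht {..<r}"
    by (rule linorder_inj_onI) (auto dest: ht_neq)
  then show ?thesis unfolding slow_perm_def
    using ht_pos ht_le_r ht_Suc_le by (auto simp: Suc_le_eq)
qed

section \<open>Generators and their Jordan chains\<close>

definition gen_poly :: "nat \<Rightarrow> int poly" where
  "gen_poly a = (SOME g. \<exists>b. annihilates a (ht a) g b)"

lemma gen_poly: "a < r \<Longrightarrow> \<exists>b. annihilates a (ht a) (gen_poly a) b"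
  unfolding gen_poly_def using annihilates_ht by (rule someI_ex)

definition gen :: "nat \<Rightarrow> int poly poly" where
  "gen a = homogenize var_x zz a (gen_poly a)"

definition part :: "nat \<Rightarrow> nat" where
  "part a = s + ht a - Suc a"

lemma zz_power_gen_null:
  assumes a: "a < r"
  shows "zz ^ part a * gen a \<in> I"
proof -
  obtain b where b: "annihilates a (ht a) (gen_poly a) b" using gen_poly[OF a] by blast
  \<comment> \<open>A degree bound for \<open>(1 - X) ^ s * b\<close>, equal to
    \<open>a + part a\<close>.\<close>
  define N where "N = (ht a - 1) + s"
  have N: "a \<le> N" "part a = N - a" using a r_le_s ht_pos[OF a] by (auto simp: N_def part_def)
  let ?c = "[:1, -1:] ^ s * b"
  have 1: "homogenize var_x zz N (gen_poly a) = zz ^ part a * gen a"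
    unfolding gen_def N(2) using b by (intro homogenize_extend N) (auto simp: annihilates_def)
  have "homogenize var_x zz N ?c = (zz - var_x) ^ s * homogenize var_x zz (ht a - 1) b"
    unfolding N_def using b by (intro homogenize_mult_one_minus_power) (auto simp: annihilates_def)
  also have "zz - var_x = var_y * (1 + var_x)" by (simp add: algebra_simps)
  finally have 2: "homogenize var_x zz N ?c \<in> I"
    by (simp add: power_mult_distrib mult.assoc null_ideal_var_y_power)
  \<comment> \<open>Coefficients below \<open>r\<close> are divisible by \<open>p\<close>; all other
    terms contain \<open>x ^ r\<close>.\<close>
  have "homogenize var_x zz N (gen_poly a - ?c) \<in> I"
    unfolding homogenize_def
  proof (rule null_ideal_sum)
    fix i
    show "of_int (coeff (gen_poly a - ?c) i) * var_x ^ i * zz ^ (N - i) \<in> I"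
    proof (cases "i < r")
      case True
      then have "int p dvd coeff (gen_poly a - ?c) i" using b by (simp add: annihilates_def)
      then show ?thesis unfolding mult.assoc by (rule null_ideal_of_int)
    next
      case False
      then have "var_x ^ i * (of_int (coeff (gen_poly a - ?c) i) * zz ^ (N - i)) \<in> I"
        by (intro null_ideal_var_x_power) simp
      then show ?thesis by (simp only: mult_ac)
    qed
  qed
  from null_ideal_add[OF this 2] show ?thesis by (simp add: homogenize_diff 1)
qed

definition basis :: "int poly poly list" where
  "basis = concat (map (\<lambda>a. map (\<lambda>k. zz ^ k * gen a) [0..<part a]) [0..<r])"

text \<open>Since \<open>ht\<close> permutes \<open>{1..r}\<close>, the sums of \<open>ht a\<close>
  and of \<open>Suc a\<close> cancel.\<close>

lemma sum_list_part: "sum_list (map part [0..<r]) = r * s"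
proof -
  have "part a + Suc a = s + ht a" if "a < r" for a
    using that r_le_s by (simp add: part_def)
  then have "(\<Sum>a<r. part a) + (\<Sum>a<r. Suc a) = (\<Sum>a<r. s + ht a)"
    unfolding sum.distrib[symmetric] by (intro sum.cong) auto
  moreover have "(\<Sum>a<r. ht a) = (\<Sum>a<r. Suc a)"
  proof -
    have "(\<Sum>a<r. ht a) = \<Sum>(ht ` {..<r})"
      using slow_perm_ht by (simp add: slow_perm_def sum.reindex)
    also have "\<dots> = \<Sum>(Suc ` {..<r})"
      unfolding slow_perm_image[OF slow_perm_ht] by (simp add: image_Suc_lessThan)
    finally show ?thesis by (simp add: sum.reindex)
  qed
  ultimately have "(\<Sum>a<r. part a) = r * s" by (simp add: sum.distrib)
  then show ?thesis by (simp add: interv_sum_list_conv_sum_set_nat lessThan_atLeast0)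
qed

lemma length_basis: "length basis = r * s"
  using sum_list_part by (simp add: basis_def length_concat comp_def)

section \<open>The chains span the coordinate ring\<close>

definition spn :: "int poly poly set" where
  "spn = {f. \<exists>c. f - (\<Sum>i<r * s. of_int (c i) * basis ! i) \<in> I}"

lemma spn_null: "f \<in> I \<Longrightarrow> f \<in> spn"
  unfolding spn_def by (auto intro!: exI[of _ "\<lambda>_. 0"])

lemma spn_add:
  assumes "f \<in> spn" "g \<in> spn"
  shows "f + g \<in> spn"
proof -
  obtain c d where "f - (\<Sum>i<r * s. of_int (c i) * basis ! i) \<in> I"
    "g - (\<Sum>i<r * s. of_int (d i) * basis ! i) \<in> I"
    using assms unfolding spn_def by blast
  from null_ideal_add[OF this]
  have "f + g - (\<Sum>i<r * s. of_int (c i + d i) * basis ! i) \<in> I"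
    by (simp add: algebra_simps sum.distrib)
  then show ?thesis unfolding spn_def by (intro CollectI exI)
qed

lemma spn_of_int_mult:
  assumes "f \<in> spn"
  shows "of_int k * f \<in> spn"
proof -
  obtain c where "f - (\<Sum>i<r * s. of_int (c i) * basis ! i) \<in> I"
    using assms unfolding spn_def by blast
  from null_ideal_mult[OF this, of "of_int k"]
  have "of_int k * f - (\<Sum>i<r * s. of_int (k * c i) * basis ! i) \<in> I"
    by (simp add: algebra_simps sum_distrib_left)
  then show ?thesis unfolding spn_def by (intro CollectI exI)
qed

lemma spn_diff: "f \<in> spn \<Longrightarrow> g \<in> spn \<Longrightarrow> f - g \<in> spn"
  using spn_add[of f "of_int (-1) * g"] spn_of_int_mult[of g "-1"] by simp

lemma spn_sum: "(\<And>a. a \<in> A \<Longrightarrow> f a \<in> spn) \<Longrightarrow> sum f A \<in> spn"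
  by (induction A rule: infinite_finite_induct) (auto intro: spn_add spn_null null_ideal_0)

lemma spn_basis:
  assumes "f \<in> set basis"
  shows "f \<in> spn"
proof -
  obtain i where i: "i < r * s" "basis ! i = f"
    using assms length_basis by (metis in_set_conv_nth)
  have "(\<Sum>j<r * s. of_int (if j = i then 1 else 0) * basis ! j) =
    (\<Sum>j<r * s. if j = i then basis ! j else 0)"
    by (intro sum.cong) auto
  then have "f - (\<Sum>j<r * s. of_int (if j = i then 1 else 0) * basis ! j) = 0"
    using i by simp
  then show ?thesis unfolding spn_def using null_ideal_0
    by (intro CollectI exI[of _ "\<lambda>j. if j = i then 1 else 0"]) simp
qed

lemma spn_zz_power_gen:
  assumes a: "a < r"
  shows "zz ^ k * gen a \<in> spn"
proof (cases "k < part a")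
  case True
  then show ?thesis using a by (intro spn_basis) (auto simp: basis_def intro!: bexI[of _ a])
next
  case False
  then have "zz ^ k = zz ^ (k - part a) * zz ^ part a" by (simp flip: power_add)
  then show ?thesis using null_ideal_mult[OF zz_power_gen_null[OF a], of "zz ^ (k - part a)"]
    by (intro spn_null) (simp only: mult.assoc)
qed

lemma spn_mult_closed:
  assumes "\<And>a k. a < r \<Longrightarrow> h * (zz ^ k * gen a) \<in> spn" and "f \<in> spn"
  shows "h * f \<in> spn"
proof -
  obtain c where c: "f - (\<Sum>i<r * s. of_int (c i) * basis ! i) \<in> I"
    using assms(2) unfolding spn_def by blast
  have "h * basis ! i \<in> spn" if "i < r * s" for i
  proof -
    have "basis ! i \<in> set basis" using that length_basis by simp
    then show ?thesis using assms(1) by (auto simp: basis_def)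
  qed
  then have "(\<Sum>i<r * s. of_int (c i) * (h * basis ! i)) \<in> spn"
    by (intro spn_sum spn_of_int_mult) auto
  from spn_add[OF spn_null[OF null_ideal_mult[OF c, of h]] this]
  show ?thesis by (simp add: algebra_simps sum_distrib_left)
qed

lemma spn_zz_mult: "f \<in> spn \<Longrightarrow> zz * f \<in> spn"
  by (rule spn_mult_closed) (use spn_zz_power_gen in \<open>simp_all only: mult.assoc[symmetric] power_Suc[symmetric]\<close>)

text \<open>In \<open>zz ^ k * gen a\<close> the coefficient of \<open>x ^ a\<close> is prime to
  \<open>p\<close>, so the term can be solved for, leaving smaller powers of \<open>x\<close> for
  the induction. From \<open>x ^ r\<close> on everything is null.\<close>

lemma spn_var_x_power_zz_power: "var_x ^ a * zz ^ k \<in> spn"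
proof (induction a arbitrary: k rule: less_induct)
  case (less a)
  show ?case
  proof (cases "a < r")
    case False
    then show ?thesis by (intro spn_null null_ideal_var_x_power) simp
  next
    case True
    define c where "c = coeff (gen_poly a) a"
    have c: "\<not> int p dvd c" using gen_poly[OF True] by (auto simp: c_def annihilates_def)
    let ?t = "\<lambda>i. of_int (coeff (gen_poly a) i) * (var_x ^ i * zz ^ (a - i + k))"
    have "zz ^ k * gen a = (\<Sum>i\<le>a. ?t i)"
      by (simp add: gen_def homogenize_def sum_distrib_left power_add mult_ac
        del: Nat.add_diff_assoc Nat.add_diff_assoc2)
    also have "\<dots> = (\<Sum>i<a. ?t i) + of_int c * (var_x ^ a * zz ^ k)"
      by (simp add: c_def flip: lessThan_Suc_atMost)
    finally have "of_int c * (var_x ^ a * zz ^ k) = zz ^ k * gen a - (\<Sum>i<a. ?t i)"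
      by (simp add: algebra_simps)
    also have "\<dots> \<in> spn"
      using less.IH True by (intro spn_diff spn_zz_power_gen spn_sum spn_of_int_mult) auto
    finally have cx: "of_int c * (var_x ^ a * zz ^ k) \<in> spn" .
    have "coprime c (int p)"
      using prime_imp_coprime[of "int p" c] c prime_p by (simp add: coprime_commute)
    then obtain d where "[c * d = 1] (mod int p)" using cong_solve_coprime_int by blast
    \<comment> \<open>With \<open>d\<close> inverse to \<open>c\<close>, split \<open>w\<close> as
      \<open>(1 - d * c) * w + d * (c * w)\<close>; the first summand is null.\<close>
    then have "int p dvd 1 - d * c" by (simp add: cong_iff_dvd_diff dvd_diff_commute mult.commute)
    from spn_add[OF spn_null[OF null_ideal_of_int[OF this, of "var_x ^ a * zz ^ k"]]
        spn_of_int_mult[OF cx, of d]]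
    have "of_int (1 - d * c) * (var_x ^ a * zz ^ k) + of_int d * (of_int c * (var_x ^ a * zz ^ k)) \<in> spn" .
    moreover have "of_int (1 - d * c) * w + of_int d * (of_int c * w) = w" for w :: "int poly poly"
      by (simp add: algebra_simps)
    ultimately show ?thesis by metis
  qed
qed

lemma spn_var_x_mult:
  assumes "f \<in> spn"
  shows "var_x * f \<in> spn"
proof (rule spn_mult_closed[OF _ assms])
  fix a k assume "a < r"
  have "var_x * (zz ^ k * gen a) =
    (\<Sum>i\<le>a. of_int (coeff (gen_poly a) i) * (var_x ^ Suc i * zz ^ (a - i + k)))"
    by (simp add: gen_def homogenize_def sum_distrib_left power_add mult_ac
        del: Nat.add_diff_assoc Nat.add_diff_assoc2)
  also have "\<dots> \<in> spn" by (intro spn_sum spn_of_int_mult spn_var_x_power_zz_power)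
  finally show "var_x * (zz ^ k * gen a) \<in> spn" .
qed

text \<open>\<open>1 + x\<close> is a unit modulo \<open>x\<^sup>r\<close>.\<close>

lemma spn_cancel_one_plus_var_x:
  assumes "(1 + var_x) * g \<in> spn"
  shows "g \<in> spn"
proof -
  have xp: "var_x ^ k * f \<in> spn" if "f \<in> spn" for k f
    by (induction k) (use that in \<open>auto simp: mult.assoc intro: spn_var_x_mult\<close>)
  \<comment> \<open>Descend from the null element \<open>x ^ r * g\<close>, using
    \<open>x ^ k * g = x ^ k * (1 + x) * g - x ^ Suc k * g\<close>.\<close>
  have "var_x ^ 0 * g \<in> spn"
  proof (rule inc_induct[of 0 r])
    show "var_x ^ r * g \<in> spn" by (intro spn_null null_ideal_var_x_power) simp
  next
    fix k assume "var_x ^ Suc k * g \<in> spn"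
    with xp[OF assms, of k] have "var_x ^ k * ((1 + var_x) * g) - var_x ^ Suc k * g \<in> spn"
      by (rule spn_diff)
    then show "var_x ^ k * g \<in> spn" by (simp add: algebra_simps)
  qed simp
  then show ?thesis by simp
qed

text \<open>\<open>(1 + x) * y = zz - x\<close>, and the factor \<open>1 + x\<close> can be
  cancelled.\<close>

lemma spn_var_y_mult:
  assumes "f \<in> spn"
  shows "var_y * f \<in> spn"
proof (rule spn_cancel_one_plus_var_x)
  have "zz * f - var_x * f \<in> spn" using assms by (intro spn_diff spn_zz_mult spn_var_x_mult)
  then show "(1 + var_x) * (var_y * f) \<in> spn" by (simp add: algebra_simps)
qed

lemma spn_monomial: "var_x ^ i * var_y ^ k \<in> spn"
proof -
  have "1 \<in> spn" using spn_var_x_power_zz_power[of 0 0] by simp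
  then have "var_y ^ k \<in> spn" by (induction k) (auto intro: spn_var_y_mult)
  then show ?thesis by (induction i) (auto simp: mult.assoc intro: spn_var_x_mult)
qed

text \<open>The rows of \<open>P\<close> are the basis elements. Spanning makes \<open>P\<close>
  invertible, and multiplication by \<open>1 + zz\<close> adds to each chain element its
  successor.\<close>

lemma similar_jordan_sum:
  "similar_mod p (r * s) (kron r s (Jmat r) (Jmat s)) (jordan_sum (map part [0..<r]))"
proof -
  let ?n = "r * s"
  define P where "P i j = coeff2 (basis ! i) (j div s) (j mod s)" for i j
  have idx: "j div s < r" "j mod s < s" if "j < ?n" for j
    using that by (auto simp: less_mult_imp_div_less intro!: mod_less_divisor gr0I)
  have "\<exists>c. var_x ^ (j div s) * var_y ^ (j mod s) - (\<Sum>i<?n. of_int (c i) * basis ! i) \<in> I" for j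
    using spn_monomial unfolding spn_def by blast
  \<comment> \<open>Row \<open>j\<close> of \<open>Q\<close> holds coordinates of the
    \<open>j\<close>-th monomial in the basis.\<close>
  then obtain Q where Q: "\<And>j. var_x ^ (j div s) * var_y ^ (j mod s) - (\<Sum>i<?n. of_int (Q j i) * basis ! i) \<in> I"
    by metis
  have "[matmul ?n Q P i j = (if i = j then 1 else 0)] (mod int p)" if "i < ?n" "j < ?n" for i j
  proof -
    have "int p dvd (if j div s = i div s \<and> j mod s = i mod s then 1 else 0) - matmul ?n Q P i j"
      using Q[of i] idx[OF that(2)]
      by (simp add: null_ideal_def coeff2_sum coeff2_monomial P_def matmul_def)
    moreover have "j div s = i div s \<and> j mod s = i mod s \<longleftrightarrow> i = j"
      by (metis div_mult_mod_eq)
    ultimately show ?thesis by (simp add: cong_iff_dvd_diff dvd_diff_commute)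
  qed
  then obtain R where R: "\<forall>i<?n. \<forall>j<?n. [matmul ?n P R i j = (if i = j then 1 else 0)] (mod int p)"
    using left_inverse_imp_right_inverse_mod[of p ?n Q P] prime_gt_1_nat[OF prime_p] by blast
  have "[matmul ?n P (kron r s (Jmat r) (Jmat s)) i j = matmul ?n (jordan_sum (map part [0..<r])) P i j] (mod int p)"
    if i: "i < ?n" and j: "j < ?n" for i j
  proof -
    let ?c = "\<lambda>f. coeff2 f (j div s) (j mod s)"
    obtain a k where a: "a < r" and k: "k < part a" and bi: "basis ! i = zz ^ k * gen a"
      and rest: "block_rest (map part [0..<r]) i = part a - Suc k"
      and next_i: "Suc k < part a \<longrightarrow> basis ! Suc i = zz ^ Suc k * gen a"
      using nth_concat_chains[of i "\<lambda>a k. zz ^ k * gen a" part "[0..<r]"] i length_basis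
      unfolding basis_def by auto
    have "matmul ?n P (kron r s (Jmat r) (Jmat s)) i j = ?c ((1 + var_x) * (1 + var_y) * basis ! i)"
      unfolding matmul_def P_def by (rule coeff2_mult_kron[OF j])
    also have "(1 + var_x) * (1 + var_y) * basis ! i = basis ! i + zz ^ Suc k * gen a"
      unfolding bi by (simp add: algebra_simps)
    finally have L: "matmul ?n P (kron r s (Jmat r) (Jmat s)) i j = P i j + ?c (zz ^ Suc k * gen a)"
      by (simp only: P_def[of i j] coeff2_simps)
    have "matmul ?n (jordan_sum (map part [0..<r])) P i j = P i j + (if Suc k < part a then P (Suc i) j else 0)"
      using jordan_sum_row[of i "map part [0..<r]" "\<lambda>i. P i j"] i rest
      unfolding sum_list_part by (simp add: matmul_def)
    moreover have "[?c (zz ^ Suc k * gen a) = (if Suc k < part a then P (Suc i) j else 0)] (mod int p)"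
    proof (cases "Suc k < part a")
      case True
      then show ?thesis using next_i by (simp add: P_def)
    next
      case False
      \<comment> \<open>At the end of a chain the successor is null, matching the end of the Jordan
        block.\<close>
      then have "Suc k = part a" using k by simp
      then have "zz ^ Suc k * gen a \<in> I" using zz_power_gen_null[OF a] by simp
      then show ?thesis using False idx[OF j] by (simp add: null_ideal_def cong_0_iff)
    qed
    ultimately show ?thesis unfolding L by (simp only: cong_add_lcancel)
  qed
  with R show ?thesis unfolding similar_mod_def by blast
qed

text \<open>The sizes decrease weakly because \<open>ht\<close> gains at most one per step;
  uniqueness of the Jordan form then resolves the description.\<close>

lemma jlambda_eq: "jlambda r s p = map part [0..<r]"
proof -
  have step: "part (Suc a) \<le> part a" if "Suc a < r" for a
    using ht_Suc_le[OF that] by (simp add: part_def)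
  have "part b \<le> part a" if "a \<le> b" "b < r" for a b
    using that by (induction b rule: dec_induct) (auto intro: le_trans step)
  then have sorted: "sorted_wrt (\<ge>) (map part [0..<r])"
    by (simp add: sorted_wrt_iff_nth_less)
  have pos: "\<forall>x\<in>set (map part [0..<r]). 0 < x"
    using r_le_s ht_pos by (force simp: part_def)
  show ?thesis unfolding jlambda_def
    using sorted pos sum_list_part similar_jordan_sum jordan_form_unique prime_gt_1_nat[OF prime_p]
    by (intro the_equality) blast+
qed

lemma deviation_eq: "deviation r s p = map (\<lambda>a. int (ht a) - 1 - int a) [0..<r]"
  using r_le_s by (auto simp: deviation_def jlambda_eq part_def)

end

theorem theorem6:
  fixes r :: nat
  assumes "1 \<le> r"
  shows "finite {deviation r s p | s p. r \<le> s \<and> prime p} \<and>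
         card {deviation r s p | s p. r \<le> s \<and> prime p} \<le> 2 ^ (r - 1)"
proof -
  \<comment> \<open>This set mentions neither \<open>s\<close> nor \<open>p\<close>, so one bound
    serves them all.\<close>
  let ?D = "{map (\<lambda>a. int (m a) - 1 - int a) [0..<r] | m. slow_perm r m}"
  have "deviation r s p \<in> ?D" if "r \<le> s" "prime p" for s p
  proof -
    interpret jordan_tensor r s p using that by unfold_locales
    show ?thesis using deviation_eq slow_perm_ht by blast
  qed
  then have "{deviation r s p | s p. r \<le> s \<and> prime p} \<subseteq> ?D" by blast
  then show ?thesis using card_slow_perm_deviations[of r]
    by (meson card_mono finite_subset le_trans)
qed

end
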